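(* Let $b\ge2$ be an integer. For all positive integers $N$, \[ S_{b,N}(x)S_{b,N}(y)=S_{b,N}(x+y). \]
   Context: For a variable $z$ and non-negative integer $d$, $\binom{z}{d}=z(z-1)\cdots(z-d+1)/d!$. Rows and columns are indexed from $0$. $S_{b,1}(x)$ is the $b\times b$ lower-triangular matrix whose $(j,k)$-entry is $\binom{x+j-k-1}{j-k}$ if $0\le k\le j\le b-1$ and $0$ otherwise; for $N\ge1$, $S_{b,N+1}(x)=S_{b,1}(x)\otimes S_{b,N}(x)$ ($\otimes$ the Kronecker product), a $b^N\times b^N$ matrix with polynomial entries. *)

theory Defs
  imports
    "Jordan_Normal_Form.Matrix"
    "HOL-Computational_Algebra.Polynomial"
begin

definition kronecker :: "'a :: times mat \<Rightarrow> 'a mat \<Rightarrow> 'a mat" where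
  "kronecker A B = mat (dim_row A * dim_row B) (dim_col A * dim_col B)
     (\<lambda>(i, j). A $$ (i div dim_row B, j div dim_col B) * B $$ (i mod dim_row B, j mod dim_col B))"

(* The type of the library constant gchoose is restricted to fields of characteristic 0, whereas
   z may be an indeterminate here. Over a field, binom is gchoose; in bivariate polynomials over
   a field of characteristic 0 the division is exact, because fact d is a unit there. See the
   two lemmas below. *)
definition binom :: "'a :: {idom_divide, ring_char_0} \<Rightarrow> nat \<Rightarrow> 'a" where
  "binom z d = (\<Prod>i<d. z - of_nat i) div fact d"

lemma binom_eq_gchoose: "binom z d = z gchoose d"
  by (simp add: binom_def gbinomial_prod_rev atLeast0LessThan)

lemma binom_bivariate_poly:
  fixes z :: "'a :: field_char_0 poly poly"
  shows "fact d * binom z d = (\<Prod>i<d. z - of_nat i)"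
proof -
  have "fact d = ([:[:fact d:]:] :: 'a poly poly)"
    by (metis of_nat_fact of_nat_poly)
  then have "fact d * [:[:inverse (fact d):]:] = (1 :: 'a poly poly)"
    by (simp add: one_pCons)
  then have "fact d dvd (1 :: 'a poly poly)"
    by (metis dvd_triv_left)
  then have "fact d dvd (\<Prod>i<d. z - of_nat i)"
    using dvd_trans one_dvd by blast
  then show ?thesis
    by (simp add: binom_def)
qed

definition S1 :: "nat \<Rightarrow> 'a :: {idom_divide, ring_char_0} \<Rightarrow> 'a mat" where
  "S1 b x = mat b b
     (\<lambda>(j, k). if k \<le> j then binom (x + of_nat j - of_nat k - 1) (j - k) else 0)"

(* S b N x is meant for N \<ge> 1 only; the value at N = 0 is an arbitrary completion.
   The argument x may be an element of a field of characteristic 0, or an indeterminate,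
   i.e. an element of a polynomial ring over such a field. *)
fun S :: "nat \<Rightarrow> nat \<Rightarrow> 'a :: {idom_divide, ring_char_0} \<Rightarrow> 'a mat" where
  "S b 0 x = 1\<^sub>m 1"
| "S b (Suc 0) x = S1 b x"
| "S b (Suc (Suc N)) x = kronecker (S1 b x) (S b (Suc N) x)"

lemma S_carrier: "S b N x \<in> carrier_mat (b ^ N) (b ^ N)"
  by (induction b N x rule: S.induct) (auto simp: S1_def kronecker_def)

(* Elements of 'a poly poly are polynomials in two variables; the inner indeterminate is X
   and the outer one is Y. *)
definition X :: "'a :: comm_ring_1 poly poly" where
  "X = [:[:0, 1:]:]"

definition Y :: "'a :: comm_ring_1 poly poly" where
  "Y = [:0, 1:]"

end

theory Submission
  imports Defs
begin

text \<open>
  Clearing the denominator, the entries of \<open>S b 1 x\<close> are rising factorials, so that the case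
  \<open>N = 1\<close> is the binomial theorem for rising factorials; the mixed product property of the
  Kronecker product does the rest. The argument needs only that factorials are units, which holds
  in a field of characteristic 0 and in bivariate polynomials over it alike.
\<close>

text \<open>Cut the range into \<open>m\<close> blocks of length \<open>n\<close>: on block
  \<open>p\<close> the quotient is constantly \<open>p\<close> and the remainder runs through all
  \<open>q < n\<close>.\<close>

lemma sum_less_mult_div_mod:
  fixes f :: "nat \<Rightarrow> nat \<Rightarrow> 'a :: comm_monoid_add"
  shows "(\<Sum>l<m * n. f (l div n) (l mod n)) = (\<Sum>p<m. \<Sum>q<n. f p q)"
proof -
  have "(\<Sum>l<m * n. f (l div n) (l mod n))
      = (\<Sum>p<m. \<Sum>l = p * n..<p * n + n. f (l div n) (l mod n))"
    by (simp add: sum.nat_group)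
  also have "\<dots> = (\<Sum>p<m. \<Sum>q<n. f p q)"
  proof (rule sum.cong[OF refl])
    fix p
    have "(\<Sum>l = p * n..<p * n + n. f (l div n) (l mod n))
        = (\<Sum>q<n. f ((q + p * n) div n) ((q + p * n) mod n))"
      using sum.shift_bounds_nat_ivl[of "\<lambda>l. f (l div n) (l mod n)" 0 "p * n" n]
      by (simp add: add.commute atLeast0LessThan)
    also have "\<dots> = (\<Sum>q<n. f p q)"
      by (rule sum.cong) auto
    finally show "(\<Sum>l = p * n..<p * n + n. f (l div n) (l mod n)) = (\<Sum>q<n. f p q)" .
  qed
  finally show ?thesis .
qed

text \<open>The inner index \<open>l\<close> of the left-hand product encodes a pair (quotient,
  remainder) by \<open>dim_row D\<close>, so its sum is a double sum whose terms separate, that is,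
  a product of two matrix entries.\<close>

lemma kronecker_mult_kronecker:
  fixes A B C D :: "'a :: comm_semiring_0 mat"
  assumes "dim_col A = dim_row C" and "dim_col B = dim_row D"
  shows "kronecker A B * kronecker C D = kronecker (A * C) (B * D)"
proof (rule eq_matI)
  fix i j
  assume "i < dim_row (kronecker (A * C) (B * D))" and "j < dim_col (kronecker (A * C) (B * D))"
  then have i: "i < dim_row A * dim_row B" and j: "j < dim_col C * dim_col D"
    by (simp_all add: kronecker_def)
  \<comment> \<open>Positivity puts the remainders \<open>i mod dim_row B\<close> and
    \<open>j mod dim_col D\<close> in range.\<close>
  have pos: "dim_row B > 0" "dim_col D > 0"
    using i j by (auto intro: Nat.gr0I)
  have quot: "i div dim_row B < dim_row A" "j div dim_col D < dim_col C"
    using i j by (simp_all add: less_mult_imp_div_less)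
  let ?f = "\<lambda>p q. (A $$ (i div dim_row B, p) * C $$ (p, j div dim_col D))
    * (B $$ (i mod dim_row B, q) * D $$ (q, j mod dim_col D))"
  have "(kronecker A B * kronecker C D) $$ (i, j)
      = (\<Sum>l<dim_row C * dim_row D. ?f (l div dim_row D) (l mod dim_row D))"
    using i j assms
    by (simp add: kronecker_def scalar_prod_def atLeast0LessThan mult_ac)
  also have "\<dots> = (\<Sum>p<dim_row C. \<Sum>q<dim_row D. ?f p q)"
    by (rule sum_less_mult_div_mod)
  also have "\<dots> = kronecker (A * C) (B * D) $$ (i, j)"
    using i j pos quot assms
    by (simp add: kronecker_def scalar_prod_def atLeast0LessThan sum_product)
  finally show "(kronecker A B * kronecker C D) $$ (i, j) = kronecker (A * C) (B * D) $$ (i, j)" .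
qed (simp_all add: kronecker_def)

text \<open>The falling product from \<open>z + d - 1\<close> has the factors of the rising
  factorial of \<open>z\<close> in reverse order; a unit \<open>fact d\<close> makes the
  \<open>div\<close> in \<open>binom\<close> exact.\<close>

lemma fact_mult_binom_eq_pochhammer:
  fixes z :: "'a :: {idom_divide, ring_char_0}"
  assumes "(fact d :: 'a) dvd 1"
  shows "fact d * binom (z + of_nat d - 1) d = pochhammer z d"
proof -
  have "(\<Prod>i<d. z + of_nat d - 1 - of_nat i) = (\<Prod>i<d. z + of_nat (d - Suc i))"
    by (rule prod.cong) (auto simp: of_nat_diff)
  also have "\<dots> = pochhammer z d"
    by (simp only: prod.nat_diff_reindex[of "\<lambda>k. z + of_nat k"] pochhammer_prod
        atLeast0LessThan)
  finally have "(\<Prod>i<d. z + of_nat d - 1 - of_nat i) = pochhammer z d" .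
  moreover obtain c where "pochhammer z d = fact d * c"
    using dvd_trans[OF assms one_dvd, of "pochhammer z d"] by (rule dvdE)
  ultimately show ?thesis
    by (simp add: binom_def)
qed

lemma binom_rising_Vandermonde:
  fixes x y :: "'a :: {idom_divide, ring_char_0}"
  assumes unit: "\<And>d. (fact d :: 'a) dvd 1"
  shows "(\<Sum>k\<le>n. binom (x + of_nat k - 1) k * binom (y + of_nat (n - k) - 1) (n - k))
    = binom (x + y + of_nat n - 1) n"
    (is "?L = ?R")
proof -
  have "fact n * ?L = (\<Sum>k\<le>n. of_nat (n choose k) * pochhammer x k * pochhammer y (n - k))"
    unfolding sum_distrib_left
  proof (rule sum.cong[OF refl])
    fix k assume "k \<in> {..n}"
    then have "fact n = of_nat (n choose k) * fact k * (fact (n - k) :: 'a)"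
      using binomial_fact_lemma[of k n]
      by (metis (no_types, lifting) atMost_iff mult.assoc mult.commute of_nat_fact of_nat_mult)
    then show "fact n * (binom (x + of_nat k - 1) k * binom (y + of_nat (n - k) - 1) (n - k))
        = of_nat (n choose k) * pochhammer x k * pochhammer y (n - k)"
      by (simp flip: fact_mult_binom_eq_pochhammer[OF unit] add: mult_ac)
  qed
  also have "\<dots> = pochhammer (x + y) n"
    by (simp add: pochhammer_binomial_sum)
  also have "\<dots> = fact n * ?R"
    by (simp add: fact_mult_binom_eq_pochhammer[OF unit])
  \<comment> \<open>Characteristic 0 makes \<open>fact n\<close> nonzero, so it cancels in the
    integral domain.\<close>
  finally show ?thesis
    by simp
qed

lemma S1_index:
  assumes "i < b" and "j < b"
  shows "S1 b x $$ (i, j) = (if j \<le> i then binom (x + of_nat (i - j) - 1) (i - j) else 0)"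
  using assms by (simp add: S1_def of_nat_diff add_diff_eq)

text \<open>An entry of \<open>S1\<close> depends only on the difference of its indices, so an entry
  of the product is a convolution of rising binomials.\<close>

lemma S1_mult_S1:
  fixes x y :: "'a :: {idom_divide, ring_char_0}"
  assumes unit: "\<And>d. (fact d :: 'a) dvd 1"
  shows "S1 b x * S1 b y = S1 b (x + y)"
proof (rule eq_matI)
  fix i j
  assume "i < dim_row (S1 b (x + y))" and "j < dim_col (S1 b (x + y))"
  then have ij: "i < b" "j < b"
    by (simp_all add: S1_def)
  let ?h = "\<lambda>z d. binom (z + of_nat d - 1) d :: 'a"
  have "(S1 b x * S1 b y) $$ (i, j) = (\<Sum>l<b. S1 b x $$ (i, l) * S1 b y $$ (l, j))"
    using ij by (simp add: S1_def scalar_prod_def atLeast0LessThan)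
  also have "\<dots> = (\<Sum>l<b. if j \<le> l \<and> l \<le> i then ?h x (i - l) * ?h y (l - j) else 0)"
    using ij by (intro sum.cong) (auto simp: S1_index)
  \<comment> \<open>For \<open>i < j\<close> this interval is empty, which gives the zeros above the
    diagonal.\<close>
  also have "\<dots> = (\<Sum>l = j..i. ?h x (i - l) * ?h y (l - j))"
    using ij by (intro sum.mono_neutral_cong_right) auto
  also have "\<dots> = S1 b (x + y) $$ (i, j)"
  proof (cases "j \<le> i")
    case True
    have "(\<Sum>l = j..i. ?h x (i - l) * ?h y (l - j))
        = (\<Sum>k\<le>i - j. ?h x k * ?h y (i - j - k))"
      using True
      \<comment> \<open>With \<open>k = i - l\<close>, the other difference \<open>l - j\<close>
        becomes \<open>i - j - k\<close>.\<close>
      by (intro sum.reindex_bij_witness[of _ "\<lambda>k. i - k" "\<lambda>l. i - l"]) auto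
    also have "\<dots> = ?h (x + y) (i - j)"
      by (rule binom_rising_Vandermonde[OF unit])
    finally show ?thesis
      using True ij by (simp only: S1_index if_True)
  qed (use ij in \<open>simp add: S1_index\<close>)
  finally show "(S1 b x * S1 b y) $$ (i, j) = S1 b (x + y) $$ (i, j)" .
qed (simp_all add: S1_def)

lemma S_mult_S:
  fixes x y :: "'a :: {idom_divide, ring_char_0}"
  assumes unit: "\<And>d. (fact d :: 'a) dvd 1"
  shows "S b N x * S b N y = S b N (x + y)"
proof (induction b N x rule: S.induct)
  case (3 b N x)
  have "dim_col (S1 b x) = dim_row (S1 b y)"
    by (simp add: S1_def)
  moreover have "dim_col (S b (Suc N) x) = dim_row (S b (Suc N) y)"
    using S_carrier[of b "Suc N"] by (metis carrier_matD)
  ultimately show ?case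
    using 3 by (simp add: kronecker_mult_kronecker S1_mult_S1[OF unit])
qed (simp_all add: S1_mult_S1[OF unit])

text \<open>The inverse of the factorial in the coefficient ring, taken as a constant polynomial, is
  still an inverse.\<close>

lemma fact_poly_dvd_one:
  assumes "(fact d :: 'a :: {comm_ring_1, ring_char_0}) dvd 1"
  shows "(fact d :: 'a poly) dvd 1"
proof -
  obtain u :: 'a where "1 = fact d * u"
    using assms by (elim dvdE)
  then have "1 = fact d * [:u:]"
    by (metis mult_to_poly of_nat_fact of_nat_poly one_pCons)
  then show ?thesis
    by (rule dvdI)
qed

theorem theorem2p5:
  fixes b N :: nat
  assumes "b \<ge> 2" and "N \<ge> 1"
  shows "S b N (X :: 'a :: field_char_0 poly poly) * S b N Y = S b N (X + Y)
    \<and> (\<forall>x y :: 'a. S b N x * S b N y = S b N (x + y))"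
proof -
  have unit: "(fact d :: 'a) dvd 1" for d
    by (simp add: dvd_field_iff)
  show ?thesis
    \<comment> \<open>The bivariate identity lifts the unit property through two polynomial layers;
      the identity over the field uses \<open>unit\<close> directly.\<close>
    by (intro conjI allI S_mult_S fact_poly_dvd_one unit)
qed

end
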